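(* Let $R$ be a commutative ring containing elements $p,q,\hbar,t_1,\dots,t_n$, and let $\mathcal M$ be the free $R$-module with basis the partitions $\nu\subseteq(n-k)^k$. For $1\le i\le k$ and $\nu\subseteq(n-k)^k$, with $c=\nu_i+k+1-i$, define $R$-linear operators by $$A^{h,h}_i(\nu)=t_c\nu+\sum_{\mu}w_{\mathtt h}(\mu/\nu)\,\mu,\quad A^{h,t}_i(\nu)=t_c\nu+\sum_{\mu}w_{\mathtt t}(\mu/\nu)\,\mu\quad(\mu/\nu\text{ a ribbon with head in row }i),$$ $$A^{t,h}_i(\nu)=t_c\nu+\sum_{\mu}w_{\mathtt h}(\mu/\nu)\,\mu,\quad A^{t,t}_i(\nu)=t_c\nu+\sum_{\mu}w_{\mathtt t}(\mu/\nu)\,\mu\quad(\mu/\nu\text{ a ribbon with tail in row }i),$$ and $$B^{h,h}_i(\nu)=t_c\nu+\sum_{\lambda}w_{\mathtt h}(\nu/\lambda)\,\lambda,\quad B^{h,t}_i(\nu)=t_c\nu+\sum_{\lambda}w_{\mathtt t}(\nu/\lambda)\,\lambda\quad(\nu/\lambda\text{ a ribbon with head in row }i),$$ $$B^{t,h}_i(\nu)=t_c\nu+\sum_{\lambda}w_{\mathtt h}(\nu/\lambda)\,\lambda,\quad B^{t,t}_i(\nu)=t_c\nu+\sum_{\lambda}w_{\mathtt t}(\nu/\lambda)\,\lambda\quad(\nu/\lambda\text{ a ribbon with tail in row }i),$$ all sums over partitions inside $(n-k)^k$, where for a ribbon $\eta$, $w_{\mathtt h}(\eta)=(\hbar-(p-q)t_{\mathtt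 h(\eta)})p^{\operatorname{ht}(\eta)-1}q^{\operatorname{wd}(\eta)-1}$ and $w_{\mathtt t}(\eta)=(\hbar-(p-q)t_{\mathtt t(\eta)})p^{\operatorname{ht}(\eta)-1}q^{\operatorname{wd}(\eta)-1}$. Then for all $\lambda,\mu\subseteq(n-k)^k$ and $0\le r\le k$, with all sums over $1\le i_1<\cdots<i_r\le k$: $$\sum A^{h,h}_{i_r}\cdots A^{h,h}_{i_1}(\lambda)=\sum A^{t,h}_{i_r}\cdots A^{t,h}_{i_1}(\lambda),\qquad \sum A^{h,t}_{i_r}\cdots A^{h,t}_{i_1}(\lambda)=\sum A^{t,t}_{i_r}\cdots A^{t,t}_{i_1}(\lambda),$$ $$\sum B^{h,h}_{i_1}\cdots B^{h,h}_{i_r}(\mu)=\sum B^{t,h}_{i_1}\cdots B^{t,h}_{i_r}(\mu),\qquad \sum B^{h,t}_{i_1}\cdots B^{h,t}_{i_r}(\mu)=\sum B^{t,t}_{i_1}\cdots B^{t,t}_{i_r}(\mu).$$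
   Context: Partitions $\nu\subseteq(n-k)^k$: $n-k\ge\nu_1\ge\dots\ge\nu_k\ge0$, identified with Young diagrams, rows numbered top to bottom. A ribbon is a nonempty connected skew shape $\eta=\mu/\lambda$ containing no $2\times2$ square; head = top-right box, tail = bottom-left box; $\operatorname{ht}(\eta)$, $\operatorname{wd}(\eta)$ are its numbers of rows and columns. If the head is in row $i$ and the tail in row $j$, $\mathtt h(\eta)=\mu_i+k+1-i$ and $\mathtt t(\eta)=\lambda_j+k+1-j$. *)

theory Defs
  imports Main
begin

text \<open>Partitions nu inside the k x (n-k) box, as functions on rows 1..k
  (value 0 at row 0 and at rows > k).\<close>
definition parts :: "nat \<Rightarrow> nat \<Rightarrow> (nat \<Rightarrow> nat) set" where
  "parts n k = {\<nu>. (\<forall>i. (i = 0 \<or> k < i) \<longrightarrow> \<nu> i = 0)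
                  \<and> (\<forall>i. 1 \<le> i \<longrightarrow> i < k \<longrightarrow> \<nu> (Suc i) \<le> \<nu> i)
                  \<and> (\<forall>i. 1 \<le> i \<longrightarrow> i \<le> k \<longrightarrow> \<nu> i \<le> n - k)}"

text \<open>Boxes (row, column) of the skew shape mu/lambda; rows top to bottom, columns from 1.\<close>
definition skew :: "nat \<Rightarrow> (nat \<Rightarrow> nat) \<Rightarrow> (nat \<Rightarrow> nat) \<Rightarrow> (nat \<times> nat) set" where
  "skew k \<mu> la = {(i, j). 1 \<le> i \<and> i \<le> k \<and> la i < j \<and> j \<le> \<mu> i}"

definition box_adj :: "nat \<times> nat \<Rightarrow> nat \<times> nat \<Rightarrow> bool" where
  "box_adj a b \<longleftrightarrow>
     (fst a = fst b \<and> (snd a = Suc (snd b) \<or> snd b = Suc (snd a))) \<or>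
     (snd a = snd b \<and> (fst a = Suc (fst b) \<or> fst b = Suc (fst a)))"

definition box_connected :: "(nat \<times> nat) set \<Rightarrow> bool" where
  "box_connected S \<longleftrightarrow>
     (\<forall>a\<in>S. \<forall>b\<in>S. (a, b) \<in> {(x, y). x \<in> S \<and> y \<in> S \<and> box_adj x y}\<^sup>*)"

definition no_square :: "(nat \<times> nat) set \<Rightarrow> bool" where
  "no_square S \<longleftrightarrow> \<not> (\<exists>i j. (i, j) \<in> S \<and> (Suc i, j) \<in> S \<and> (i, Suc j) \<in> S \<and> (Suc i, Suc j) \<in> S)"

text \<open>mu/lambda is a ribbon: a (valid) nonempty connected skew shape with no 2x2 square.\<close>
definition is_ribbon :: "nat \<Rightarrow> (nat \<Rightarrow> nat) \<Rightarrow> (nat \<Rightarrow> nat) \<Rightarrow> bool" where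
  "is_ribbon k \<mu> la \<longleftrightarrow> (\<forall>i. 1 \<le> i \<longrightarrow> i \<le> k \<longrightarrow> la i \<le> \<mu> i)
     \<and> skew k \<mu> la \<noteq> {} \<and> box_connected (skew k \<mu> la) \<and> no_square (skew k \<mu> la)"

text \<open>Row of the head (top-right box) = top row; row of the tail (bottom-left box) = bottom row.\<close>
definition head_row :: "nat \<Rightarrow> (nat \<Rightarrow> nat) \<Rightarrow> (nat \<Rightarrow> nat) \<Rightarrow> nat" where
  "head_row k \<mu> la = Min (fst ` skew k \<mu> la)"

definition tail_row :: "nat \<Rightarrow> (nat \<Rightarrow> nat) \<Rightarrow> (nat \<Rightarrow> nat) \<Rightarrow> nat" where
  "tail_row k \<mu> la = Max (fst ` skew k \<mu> la)"

definition ribbon_ht :: "nat \<Rightarrow> (nat \<Rightarrow> nat) \<Rightarrow> (nat \<Rightarrow> nat) \<Rightarrow> nat" where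
  "ribbon_ht k \<mu> la = card (fst ` skew k \<mu> la)"

definition ribbon_wd :: "nat \<Rightarrow> (nat \<Rightarrow> nat) \<Rightarrow> (nat \<Rightarrow> nat) \<Rightarrow> nat" where
  "ribbon_wd k \<mu> la = card (snd ` skew k \<mu> la)"

text \<open>h(mu/lambda) = mu_i + k + 1 - i (i head row); t(mu/lambda) = lambda_j + k + 1 - j (j tail row).\<close>
definition hval :: "nat \<Rightarrow> (nat \<Rightarrow> nat) \<Rightarrow> (nat \<Rightarrow> nat) \<Rightarrow> nat" where
  "hval k \<mu> la = \<mu> (head_row k \<mu> la) + k + 1 - head_row k \<mu> la"

definition tval :: "nat \<Rightarrow> (nat \<Rightarrow> nat) \<Rightarrow> (nat \<Rightarrow> nat) \<Rightarrow> nat" where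
  "tval k \<mu> la = la (tail_row k \<mu> la) + k + 1 - tail_row k \<mu> la"

datatype rend = H | T

definition end_row :: "rend \<Rightarrow> nat \<Rightarrow> (nat \<Rightarrow> nat) \<Rightarrow> (nat \<Rightarrow> nat) \<Rightarrow> nat" where
  "end_row e k \<mu> la = (case e of H \<Rightarrow> head_row k \<mu> la | T \<Rightarrow> tail_row k \<mu> la)"

definition end_val :: "rend \<Rightarrow> nat \<Rightarrow> (nat \<Rightarrow> nat) \<Rightarrow> (nat \<Rightarrow> nat) \<Rightarrow> nat" where
  "end_val e k \<mu> la = (case e of H \<Rightarrow> hval k \<mu> la | T \<Rightarrow> tval k \<mu> la)"

text \<open>w_h (e = H) and w_t (e = T) of the ribbon mu/lambda.\<close>
definition wgt :: "rend \<Rightarrow> 'a::comm_ring_1 \<Rightarrow> 'a \<Rightarrow> 'a \<Rightarrow> (nat \<Rightarrow> 'a) \<Rightarrow> nat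
                   \<Rightarrow> (nat \<Rightarrow> nat) \<Rightarrow> (nat \<Rightarrow> nat) \<Rightarrow> 'a" where
  "wgt e p q hb t k \<mu> la =
     (hb - (p - q) * t (end_val e k \<mu> la)) * p ^ (ribbon_ht k \<mu> la - 1) * q ^ (ribbon_wd k \<mu> la - 1)"

text \<open>Elements of the free module M: coefficient functions on partitions
  (only the coefficients at partitions in the box matter / are nonzero).\<close>
type_synonym 'a vec = "(nat \<Rightarrow> nat) \<Rightarrow> 'a"

definition basis_vec :: "(nat \<Rightarrow> nat) \<Rightarrow> 'a::comm_ring_1 vec" where
  "basis_vec \<nu> = (\<lambda>\<mu>. if \<mu> = \<nu> then 1 else 0)"

text \<open>R-linear extension of a map given on basis elements.\<close>
definition lin_ext :: "nat \<Rightarrow> nat \<Rightarrow> ((nat \<Rightarrow> nat) \<Rightarrow> 'a::comm_ring_1 vec) \<Rightarrow> 'a vec \<Rightarrow> 'a vec" where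
  "lin_ext n k f v = (\<lambda>\<mu>. \<Sum>\<nu>\<in>parts n k. v \<nu> * f \<nu> \<mu>)"

text \<open>A^{x,y}_i on a basis element nu: ribbons mu/nu with x-end in row i, weight w_y.\<close>
definition A_basis :: "rend \<Rightarrow> rend \<Rightarrow> nat \<Rightarrow> nat \<Rightarrow> 'a::comm_ring_1 \<Rightarrow> 'a \<Rightarrow> 'a \<Rightarrow> (nat \<Rightarrow> 'a)
                      \<Rightarrow> nat \<Rightarrow> (nat \<Rightarrow> nat) \<Rightarrow> 'a vec" where
  "A_basis x y n k p q hb t i \<nu> = (\<lambda>\<mu>.
     (if \<mu> = \<nu> then t (\<nu> i + k + 1 - i) else 0) +
     (if \<mu> \<in> parts n k \<and> is_ribbon k \<mu> \<nu> \<and> end_row x k \<mu> \<nu> = i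
      then wgt y p q hb t k \<mu> \<nu> else 0))"

text \<open>B^{x,y}_i on a basis element nu: ribbons nu/lambda with x-end in row i, weight w_y.\<close>
definition B_basis :: "rend \<Rightarrow> rend \<Rightarrow> nat \<Rightarrow> nat \<Rightarrow> 'a::comm_ring_1 \<Rightarrow> 'a \<Rightarrow> 'a \<Rightarrow> (nat \<Rightarrow> 'a)
                      \<Rightarrow> nat \<Rightarrow> (nat \<Rightarrow> nat) \<Rightarrow> 'a vec" where
  "B_basis x y n k p q hb t i \<nu> = (\<lambda>la.
     (if la = \<nu> then t (\<nu> i + k + 1 - i) else 0) +
     (if la \<in> parts n k \<and> is_ribbon k \<nu> la \<and> end_row x k \<nu> la = i
      then wgt y p q hb t k \<nu> la else 0))"

definition A_op :: "rend \<Rightarrow> rend \<Rightarrow> nat \<Rightarrow> nat \<Rightarrow> 'a::comm_ring_1 \<Rightarrow> 'a \<Rightarrow> 'a \<Rightarrow> (nat \<Rightarrow> 'a)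
                   \<Rightarrow> nat \<Rightarrow> 'a vec \<Rightarrow> 'a vec" where
  "A_op x y n k p q hb t i = lin_ext n k (A_basis x y n k p q hb t i)"

definition B_op :: "rend \<Rightarrow> rend \<Rightarrow> nat \<Rightarrow> nat \<Rightarrow> 'a::comm_ring_1 \<Rightarrow> 'a \<Rightarrow> 'a \<Rightarrow> (nat \<Rightarrow> 'a)
                   \<Rightarrow> nat \<Rightarrow> 'a vec \<Rightarrow> 'a vec" where
  "B_op x y n k p q hb t i = lin_ext n k (B_basis x y n k p q hb t i)"

text \<open>Sum over 1 <= i_1 < ... < i_r <= k of A_{i_r} ... A_{i_1} v (A_{i_1} applied first).\<close>
definition A_sum :: "rend \<Rightarrow> rend \<Rightarrow> nat \<Rightarrow> nat \<Rightarrow> 'a::comm_ring_1 \<Rightarrow> 'a \<Rightarrow> 'a \<Rightarrow> (nat \<Rightarrow> 'a)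
                    \<Rightarrow> nat \<Rightarrow> 'a vec \<Rightarrow> 'a vec" where
  "A_sum x y n k p q hb t r v =
     (\<lambda>\<rho>. \<Sum>S\<in>{S. S \<subseteq> {1..k} \<and> card S = r}.
        fold (\<lambda>i w. A_op x y n k p q hb t i w) (sorted_list_of_set S) v \<rho>)"

text \<open>Sum over 1 <= i_1 < ... < i_r <= k of B_{i_1} ... B_{i_r} v (B_{i_r} applied first).\<close>
definition B_sum :: "rend \<Rightarrow> rend \<Rightarrow> nat \<Rightarrow> nat \<Rightarrow> 'a::comm_ring_1 \<Rightarrow> 'a \<Rightarrow> 'a \<Rightarrow> (nat \<Rightarrow> 'a)
                    \<Rightarrow> nat \<Rightarrow> 'a vec \<Rightarrow> 'a vec" where
  "B_sum x y n k p q hb t r v =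
     (\<lambda>\<rho>. \<Sum>S\<in>{S. S \<subseteq> {1..k} \<and> card S = r}.
        fold (\<lambda>i w. B_op x y n k p q hb t i w) (rev (sorted_list_of_set S)) v \<rho>)"

end

theory Submission
  imports Defs "HOL-Computational_Algebra.Polynomial"
begin

text \<open>
  Encode a partition \<open>\<nu>\<close> by the set of sites \<open>\<nu>\<^sub>i + k - i\<close>, one particle per row. Adding a ribbon moves
  one particle from an occupied site \<open>a\<close> (the tail) to a free site \<open>b > a\<close> (the head), and height and
  width count the particles and the holes strictly in between. With a formal variable marking the
  number of factors, the tail-indexed sum becomes the ordered product over the sites \<open>m\<close> of
  operators in which a particle at \<open>m\<close> stays or jumps to the right, the head-indexed sum the product
  in which \<open>m\<close> keeps its state or receives a particle from the left. These products agree by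
  induction on the number of sites: a jump into the last site commutes with every jump starting to
  the right of its source, since the latter does not change the number of particles in between.
  Finally \<open>B\<^sub>i\<close> is the transpose of \<open>A\<^sub>i\<close>.
\<close>

section \<open>Sweeps of particle jumps\<close>

definition move :: "nat set \<Rightarrow> nat \<Rightarrow> nat \<Rightarrow> nat set" where
  "move X a b = insert b (X - {a})"

text \<open>Counting from the right numbers the particles like the rows of the diagram, but from 0:
  the particle at \<open>a\<close> has row \<open>count_ge X (Suc a)\<close>.\<close>

definition count_ge :: "nat set \<Rightarrow> nat \<Rightarrow> nat" where
  "count_ge X m = card {x \<in> X. m \<le> x}"

definition jumps :: "nat \<Rightarrow> nat set \<Rightarrow> (nat \<times> nat) set" where
  "jumps n X = {(a, b). a \<in> X \<and> b \<notin> X \<and> a < b \<and> b < n}"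

text \<open>For \<open>T\<close> this is the row of the particle leaving \<open>a\<close>. For
  \<open>H\<close> it is the row that the particle has after landing at \<open>b\<close>; as
  \<open>a < b\<close>, the particles beyond \<open>b\<close> are unaffected, so it can be read off
  from \<open>X\<close> before the jump.\<close>

definition jump_row :: "rend \<Rightarrow> nat set \<Rightarrow> nat \<times> nat \<Rightarrow> nat" where
  "jump_row e X = (\<lambda>(a, b). case e of H \<Rightarrow> count_ge X b | T \<Rightarrow> count_ge X (Suc a))"

lemma finite_jumps [simp]: "finite (jumps n X)"
  by (rule finite_subset[of _ "{..<n} \<times> {..<n}"]) (auto simp: jumps_def)

lemma count_ge_Suc:
  assumes "finite X"
  shows "count_ge X m = (if m \<in> X then Suc (count_ge X (Suc m)) else count_ge X (Suc m))"
proof (cases "m \<in> X")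
  case True
  then have "{x \<in> X. m \<le> x} = insert m {x \<in> X. Suc m \<le> x}" by auto
  with True assms show ?thesis by (simp add: count_ge_def)
next
  case False
  then have "{x \<in> X. m \<le> x} = {x \<in> X. Suc m \<le> x}" by (auto simp: le_less Suc_le_eq)
  with False show ?thesis by (simp add: count_ge_def)
qed

lemma count_ge_antimono: "finite X \<Longrightarrow> m \<le> m' \<Longrightarrow> count_ge X m' \<le> count_ge X m"
  unfolding count_ge_def by (rule card_mono) auto

lemma card_move: "finite X \<Longrightarrow> a \<in> X \<Longrightarrow> b \<notin> X \<Longrightarrow> card X = k \<Longrightarrow> card (move X a b) = k"
  using card_Suc_Diff1[of X a] by (simp add: move_def)

lemma count_ge_Suc_inj:
  assumes "finite X" "a \<in> X" "m \<in> X" "count_ge X (Suc a) = count_ge X (Suc m)"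
  shows "a = m"
proof (rule ccontr)
  assume "a \<noteq> m"
  then consider "Suc a \<le> m" | "Suc m \<le> a" by linarith
  then show False
    using assms count_ge_antimono[of X "Suc a" m] count_ge_antimono[of X "Suc m" a]
      count_ge_Suc[of X a] count_ge_Suc[of X m] by cases auto
qed

lemma count_ge_move_le:
  assumes "a < m" "m \<le> b" "b \<notin> X" "finite X"
  shows "count_ge (move X a b) m = Suc (count_ge X m)"
proof -
  have "{x \<in> move X a b. m \<le> x} = insert b {x \<in> X. m \<le> x}"
    using assms by (auto simp: move_def)
  then show ?thesis using assms by (simp add: count_ge_def)
qed

lemma count_ge_move_ge:
  assumes "m \<le> a" "m \<le> b" "a \<in> X" "b \<notin> X" "finite X"
  shows "count_ge (move X a b) m = count_ge X m"
proof -
  have "{x \<in> move X a b. m \<le> x} = insert b ({x \<in> X. m \<le> x} - {a})"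
    using assms by (auto simp: move_def)
  moreover have "Suc (card ({x \<in> X. m \<le> x} - {a})) = count_ge X m"
    using assms unfolding count_ge_def by (intro card_Suc_Diff1) auto
  ultimately show ?thesis using assms by (simp add: count_ge_def)
qed

text \<open>Operators act on functions of configurations (sets of occupied sites), so in a composition
  the outermost one moves a particle first. The weights of a site and of a jump may be arbitrary
  as long as the weight of a jump depends on the sites in between only through the number of
  particles there.\<close>

locale jump_weights =
  fixes d :: "nat \<Rightarrow> 'b::comm_ring_1" and W :: "nat set \<Rightarrow> nat \<Rightarrow> nat \<Rightarrow> 'b"
  assumes W_move_between: "\<lbrakk>a < m; m < b; b < n; m \<in> X; b \<notin> X\<rbrakk> \<Longrightarrow> W (move X m b) a n = W X a n"
    and W_move_around: "\<lbrakk>a < m; m < b; b < n\<rbrakk> \<Longrightarrow> W (move X a n) m b = W X m b"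
begin

section \<open>Jump operators and the equality of the two sweeps\<close>

text \<open>The bound \<open>n\<close> on the landing sites is kept apart from the source
  \<open>m\<close>, so that the induction can open one more landing site while the sources stay
  fixed.\<close>

definition jump_from :: "nat \<Rightarrow> nat \<Rightarrow> (nat set \<Rightarrow> 'b) \<Rightarrow> nat set \<Rightarrow> 'b" where
  "jump_from n m f X = (if m \<in> X
     then d m * f X + (\<Sum>b | b \<notin> X \<and> m < b \<and> b < n. W X m b * f (move X m b)) else f X)"

definition jump_to :: "nat \<Rightarrow> (nat set \<Rightarrow> 'b) \<Rightarrow> nat set \<Rightarrow> 'b" where
  "jump_to m f X = (if m \<in> X
     then d m * f X else f X + (\<Sum>a | a \<in> X \<and> a < m. W X a m * f (move X a m)))"

text \<open>The largest site stands outermost and hence acts first. A particle that has jumped sits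
  on a site already passed and is not moved again.\<close>

primrec sweep_from :: "nat \<Rightarrow> nat \<Rightarrow> (nat set \<Rightarrow> 'b) \<Rightarrow> nat set \<Rightarrow> 'b" where
  "sweep_from n 0 f = f"
| "sweep_from n (Suc m) f = jump_from n m (sweep_from n m f)"

primrec sweep_to :: "nat \<Rightarrow> (nat set \<Rightarrow> 'b) \<Rightarrow> nat set \<Rightarrow> 'b" where
  "sweep_to 0 f = f"
| "sweep_to (Suc m) f = jump_to m (sweep_to m f)"

text \<open>The new site \<open>n\<close> receives at most one particle, and that jump can be pulled
  to the front. The jumps made before it start and end strictly between its source and
  \<open>n\<close>, so \<open>W_move_between\<close> and \<open>W_move_around\<close> preserve all
  weights; the vacated source is passed over later.\<close>

lemma sweep_from_Suc:
  assumes "m \<le> n"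
  shows "sweep_from (Suc n) m f X = sweep_from n m f X +
    (if n \<in> X then 0 else \<Sum>a | a \<in> X \<and> a < m. W X a n * sweep_from n m f (move X a n))"
  using assms
proof (induction m arbitrary: X)
  case 0
  then show ?case by simp
next
  case (Suc m)
  let ?Q = "sweep_from (Suc n) m f" and ?P = "sweep_from n m f"
  have mn: "m < n" and IH: "\<And>X. ?Q X = ?P X +
      (if n \<in> X then 0 else \<Sum>a | a \<in> X \<and> a < m. W X a n * ?P (move X a n))"
    using Suc by auto
  show ?case
  proof (cases "m \<in> X")
    case False
    then have sets: "{a. a \<in> X \<and> a < Suc m} = {a. a \<in> X \<and> a < m}"
      using less_Suc_eq by auto
    have "m \<notin> move X a n" for a using False mn by (auto simp: move_def)
    with False show ?thesis by (simp add: jump_from_def IH sets)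
  next
    case m: True
    show ?thesis
    proof (cases "n \<in> X")
      case True
      have "{b. b \<notin> X \<and> m < b \<and> b < Suc n} = {b. b \<notin> X \<and> m < b \<and> b < n}"
        using True less_Suc_eq by auto
      moreover have "n \<in> move X m b" for b using True mn by (auto simp: move_def)
      ultimately show ?thesis using True m by (simp add: jump_from_def IH)
    next
      case n: False
      let ?B = "{b. b \<notin> X \<and> m < b \<and> b < n}" and ?A = "{a. a \<in> X \<and> a < m}"
      have fin: "finite ?A" "finite ?B" by auto
      have B: "{b. b \<notin> X \<and> m < b \<and> b < Suc n} = insert n ?B" using n mn by auto
      have A: "{a. a \<in> X \<and> a < Suc m} = insert m ?A" using m by auto
      \<comment> \<open>Here \<open>n\<close> is filled already, so the extra term of the induction
        hypothesis vanishes.\<close>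
      have Qn: "?Q (move X m n) = ?P (move X m n)"
        by (simp add: IH) (simp add: move_def)
      \<comment> \<open>After a jump from \<open>m\<close> to \<open>b < n\<close> the site
        \<open>n\<close> is still free, and the induction hypothesis adds a jump from some
        \<open>a < m\<close> into it, with the weight it had in \<open>X\<close>.\<close>
      have Qb: "W X m b * ?Q (move X m b) = W X m b * ?P (move X m b) +
          (\<Sum>a\<in>?A. W X m b * (W X a n * ?P (move (move X m b) a n)))" if b: "b \<in> ?B" for b
      proof -
        have "n \<notin> move X m b" using n b by (auto simp: move_def)
        moreover have "{a. a \<in> move X m b \<and> a < m} = ?A" using b by (auto simp: move_def)
        moreover have "W (move X m b) a n = W X a n" if "a \<in> ?A" for a
          using that b m by (intro W_move_between) auto
        ultimately show ?thesis by (simp add: IH distrib_left sum_distrib_left)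
      qed
      \<comment> \<open>The same pairs of jumps in the other order: first from \<open>a\<close> to
        \<open>n\<close>, then \<open>m\<close> stays or jumps.\<close>
      have Pa: "sweep_from n (Suc m) f (move X a n) = d m * ?P (move X a n) +
          (\<Sum>b\<in>?B. W X m b * ?P (move (move X m b) a n))" if a: "a \<in> ?A" for a
      proof -
        have "m \<in> move X a n" using m a by (auto simp: move_def)
        moreover have "{b. b \<notin> move X a n \<and> m < b \<and> b < n} = ?B"
          using a by (auto simp: move_def)
        moreover have "W (move X a n) m b = W X m b" if "b \<in> ?B" for b
          using a that by (intro W_move_around) auto
        moreover have "move (move X a n) m b = move (move X m b) a n" if "b \<in> ?B" for b
          using a that mn by (auto simp: move_def)
        ultimately show ?thesis by (simp add: jump_from_def)
      qed
      have Pm: "sweep_from n (Suc m) f (move X m n) = ?P (move X m n)"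
        using mn by (simp add: jump_from_def) (simp add: move_def)
      have "sweep_from (Suc n) (Suc m) f X = d m * ?P X +
          d m * (\<Sum>a\<in>?A. W X a n * ?P (move X a n)) + W X m n * ?P (move X m n) +
          (\<Sum>b\<in>?B. W X m b * ?P (move X m b)) +
          (\<Sum>b\<in>?B. \<Sum>a\<in>?A. W X m b * (W X a n * ?P (move (move X m b) a n)))"
        using m n fin
        by (simp add: jump_from_def B Qn Qb sum.distrib) (simp add: IH algebra_simps)
      also have "(\<Sum>b\<in>?B. \<Sum>a\<in>?A. W X m b * (W X a n * ?P (move (move X m b) a n))) =
          (\<Sum>a\<in>?A. W X a n * (\<Sum>b\<in>?B. W X m b * ?P (move (move X m b) a n)))"
        by (subst sum.swap) (simp add: sum_distrib_left mult.left_commute)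
      also have "d m * ?P X + d m * (\<Sum>a\<in>?A. W X a n * ?P (move X a n)) +
          W X m n * ?P (move X m n) + (\<Sum>b\<in>?B. W X m b * ?P (move X m b)) + \<dots> =
          sweep_from n (Suc m) f X +
          (\<Sum>a\<in>insert m ?A. W X a n * sweep_from n (Suc m) f (move X a n))"
      proof -
        have "(\<Sum>a\<in>insert m ?A. W X a n * sweep_from n (Suc m) f (move X a n)) =
            W X m n * ?P (move X m n) + (\<Sum>a\<in>?A. W X a n * (d m * ?P (move X a n) +
              (\<Sum>b\<in>?B. W X m b * ?P (move (move X m b) a n))))"
          using fin by (simp add: Pm Pa del: sweep_from.simps)
        moreover have "sweep_from n (Suc m) f X =
            d m * ?P X + (\<Sum>b\<in>?B. W X m b * ?P (move X m b))"
          using m by (simp add: jump_from_def)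
        ultimately show ?thesis
          by (simp add: distrib_left sum.distrib sum_distrib_left mult.left_commute add_ac
              del: sweep_from.simps)
      qed
      finally show ?thesis using n by (simp add: A del: sweep_from.simps)
    qed
  qed
qed

theorem sweep_from_eq_sweep_to: "sweep_from n n f X = sweep_to n f X"
proof (induction n arbitrary: X)
  case 0
  then show ?case by simp
next
  case (Suc n)
  \<comment> \<open>The last site has nowhere to jump. What remains is its factor \<open>d n\<close>
    if it is occupied, and otherwise the extra sum of \<open>sweep_from_Suc\<close>, which is the
    sum of arrivals in \<open>jump_to\<close>.\<close>
  have none: "{b. b \<notin> X \<and> n < b \<and> b < Suc n} = {}" by auto
  show ?case by (simp add: jump_from_def jump_to_def none sweep_from_Suc Suc)
qed

section \<open>Row operators, and the sweeps as products over rows\<close>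

text \<open>For \<open>d a = 1 + z * t (Suc a)\<close> and jump weights divisible by
  \<open>z\<close> this is the identity plus \<open>z\<close> times the operator of row
  \<open>i\<close>. On a finite \<open>X\<close> the sum over \<open>a\<close> has at most one term,
  and none if row \<open>i\<close> does not exist.\<close>

definition row_op :: "rend \<Rightarrow> nat \<Rightarrow> nat \<Rightarrow> (nat set \<Rightarrow> 'b) \<Rightarrow> nat set \<Rightarrow> 'b" where
  "row_op e n i f X = f X + (\<Sum>a | a \<in> X \<and> count_ge X (Suc a) = i. (d a - 1) * f X) +
     (\<Sum>(a, b)\<in>{J \<in> jumps n X. jump_row e X J = i}. W X a b * f (move X a b))"

lemma row_op_T:
  assumes "finite X" "m \<in> X"
  shows "row_op T n (count_ge X (Suc m)) f X = jump_from n m f X"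
proof -
  note uniq = count_ge_Suc_inj[OF assms(1) _ assms(2)]
  have 1: "{a. a \<in> X \<and> count_ge X (Suc a) = count_ge X (Suc m)} = {m}" using assms uniq by auto
  have 2: "{J \<in> jumps n X. jump_row T X J = count_ge X (Suc m)} =
      Pair m ` {b. b \<notin> X \<and> m < b \<and> b < n}"
    using assms uniq by (auto simp: jumps_def jump_row_def)
  show ?thesis using assms
    by (simp add: row_op_def jump_from_def 1 2 sum.reindex inj_on_def algebra_simps)
qed

lemma row_op_beyond:
  assumes "finite X" "card X \<le> i"
  shows "row_op e n i f X = f X"
proof -
  have *: "count_ge X (Suc a) \<noteq> i" "count_ge X b \<noteq> i" if "a \<in> X" "a < b" for a b
  proof -
    have "count_ge X (Suc a) < count_ge X a" using that assms by (simp add: count_ge_Suc[of X a])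
    moreover have "count_ge X a \<le> card X" using assms by (auto simp: count_ge_def intro: card_mono)
    moreover have "count_ge X b \<le> count_ge X (Suc a)" using that assms count_ge_antimono by simp
    ultimately show "count_ge X (Suc a) \<noteq> i" "count_ge X b \<noteq> i" using assms by auto
  qed
  have 1: "{a. a \<in> X \<and> count_ge X (Suc a) = i} = {}" using * by blast
  have 2: "{J \<in> jumps n X. jump_row e X J = i} = {}"
    using * by (auto simp: jumps_def jump_row_def split: rend.splits)
  show ?thesis unfolding row_op_def 1 2 by simp
qed

definition rows_op :: "rend \<Rightarrow> nat \<Rightarrow> nat \<Rightarrow> nat \<Rightarrow> (nat set \<Rightarrow> 'b) \<Rightarrow> nat set \<Rightarrow> 'b" where
  "rows_op e n k i f = foldr (row_op e n) [i..<k] f"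

text \<open>For \<open>i\<close> at least \<open>k\<close> there is no such row in \<open>X\<close>,
  and both sides reduce to \<open>f X\<close>.\<close>

lemma rows_op_step:
  assumes "finite X" "card X = k"
  shows "row_op e n i (rows_op e n k (Suc i) f) X = rows_op e n k i f X"
  using assms by (cases "i < k") (simp_all add: rows_op_def upt_conv_Cons row_op_beyond)

text \<open>The sites below \<open>m\<close> carry exactly the rows from \<open>count_ge X m\<close>
  on. A jump to the right from \<open>m\<close> does not change this count, so after the step at
  \<open>m\<close> the same next row applies to every term of the sum.\<close>

lemma sweep_from_eq_rows_op:
  assumes "X \<subseteq> {..<n}" "card X = k" "m \<le> n"
  shows "sweep_from n m f X = rows_op T n k (count_ge X m) f X"
  using assms
proof (induction m arbitrary: X)
  case 0
  then show ?case by (simp add: count_ge_def rows_op_def)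
next
  case (Suc m)
  then have fin: "finite X" using finite_subset by blast
  show ?case
  proof (cases "m \<in> X")
    case False
    then have "count_ge X m = count_ge X (Suc m)" using fin by (subst count_ge_Suc) simp_all
    with False Suc.IH[of X] Suc.prems show ?thesis by (simp add: jump_from_def)
  next
    case True
    let ?i = "count_ge X (Suc m)"
    have i: "count_ge X m = Suc ?i" using True fin by (subst count_ge_Suc) simp_all
    have "sweep_from n m f (move X m b) = rows_op T n k (Suc ?i) f (move X m b)"
      if "b \<notin> X" "m < b" "b < n" for b
    proof -
      have "card (move X m b) = k"
        using that True fin Suc.prems card_move by blast
      moreover have "move X m b \<subseteq> {..<n}" using that Suc.prems by (auto simp: move_def)
      moreover have "count_ge (move X m b) m = Suc ?i"
        using that True fin i by (simp add: count_ge_move_ge)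
      ultimately show ?thesis using Suc.IH[of "move X m b"] Suc.prems by simp
    qed
    moreover have "sweep_from n m f X = rows_op T n k (Suc ?i) f X"
      using Suc.IH[of X] Suc.prems i by simp
    ultimately have "sweep_from n (Suc m) f X = jump_from n m (rows_op T n k (Suc ?i) f) X"
      using True by (simp add: jump_from_def)
    also have "\<dots> = rows_op T n k ?i f X"
      using True fin Suc.prems by (simp add: row_op_T[symmetric] rows_op_step)
    finally show ?thesis .
  qed
qed

text \<open>A site beyond the occupied \<open>m\<close> has fewer particles at or after it than
  \<open>m\<close> has. So all heads in row \<open>count_ge X m\<close> lie below \<open>m\<close>,
  and both bounds admit the same jumps.\<close>

lemma row_op_H_bound:
  assumes "finite X" "m \<in> X" "m \<le> n" "i = count_ge X m"
  shows "row_op H n i f X = row_op H m i f X"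
proof -
  have "b < m" if "b \<notin> X" "count_ge X b = count_ge X m" for b
  proof (rule ccontr)
    assume "\<not> b < m"
    with that assms have "Suc m \<le> b" by (metis Suc_leI linorder_neqE_nat)
    then have "count_ge X b \<le> count_ge X (Suc m)" using assms count_ge_antimono by blast
    then show False using that assms by (simp add: count_ge_Suc[of X m])
  qed
  then have "{J \<in> jumps n X. jump_row H X J = i} =
      {J \<in> jumps m X. jump_row H X J = i}"
    using assms by (fastforce simp: jumps_def jump_row_def)
  then show ?thesis by (simp add: row_op_def)
qed

text \<open>The heads of one row may occupy several free sites, so a sweep over the sites below
  \<open>m\<close> can begin in the middle of a row. The bound in \<open>row_op H m\<close>
  expresses this partial row, in which only heads below \<open>m\<close> remain; all later rows are
  complete.\<close>

lemma sweep_to_eq_row_op: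
  assumes "X \<subseteq> {..<n}" "card X = k" "m \<le> n"
  shows "sweep_to m f X = row_op H m (count_ge X m) (rows_op H n k (Suc (count_ge X m)) f) X"
  using assms
proof (induction m arbitrary: X)
  case 0
  then have "finite X" using finite_subset by blast
  with 0 show ?case by (simp add: count_ge_def rows_op_def row_op_beyond)
next
  case (Suc m)
  \<comment> \<open>At an occupied \<open>m\<close> the partial row is the whole row, by
    \<open>row_op_H_bound\<close>.\<close>
  have occ: "sweep_to m f Y = rows_op H n k (count_ge Y m) f Y"
    if "Y \<subseteq> {..<n}" "card Y = k" "m \<in> Y" for Y
  proof -
    have fin: "finite Y" using that finite_subset by blast
    have "sweep_to m f Y = row_op H n (count_ge Y m) (rows_op H n k (Suc (count_ge Y m)) f) Y"
      using Suc.IH[of Y] Suc.prems that fin by (simp add: row_op_H_bound[of Y m n])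
    then show ?thesis using that fin by (simp add: rows_op_step)
  qed
  have fin: "finite X" using Suc.prems finite_subset by blast
  let ?i = "count_ge X (Suc m)" and ?g = "rows_op H n k (Suc (count_ge X (Suc m))) f"
  show ?case
  proof (cases "m \<in> X")
    case True
    note uniq = count_ge_Suc_inj[OF fin _ True]
    have 1: "{a. a \<in> X \<and> count_ge X (Suc a) = ?i} = {m}" using True uniq by auto
    \<comment> \<open>Sites up to \<open>m\<close> count the particle at \<open>m\<close> as well,
      so row \<open>?i\<close> has no head left and only the factor \<open>d m\<close>
      survives.\<close>
    have "count_ge X b \<noteq> ?i" if "b < Suc m" for b
      using that True fin count_ge_antimono[of X b m] count_ge_Suc[of X m] by auto
    then have 2: "{J \<in> jumps (Suc m) X. jump_row H X J = ?i} = {}"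
      by (auto simp: jumps_def jump_row_def)
    have "count_ge X m = Suc ?i" using True fin by (subst count_ge_Suc) simp_all
    then have "sweep_to (Suc m) f X = d m * ?g X"
      using True occ[of X] Suc.prems by (simp add: jump_to_def)
    then show ?thesis by (simp only: row_op_def 1 2) (simp add: algebra_simps)
  next
    case False
    have i: "count_ge X m = ?i" using False fin by (subst count_ge_Suc) simp_all
    have "sweep_to m f (move X a m) = ?g (move X a m)" if "a \<in> X" "a < m" for a
    proof -
      have "card (move X a m) = k"
        using that False fin Suc.prems card_move by blast
      moreover have "move X a m \<subseteq> {..<n}" "m \<in> move X a m"
        using that Suc.prems by (auto simp: move_def)
      moreover have "count_ge (move X a m) m = Suc ?i"
        using that False fin i by (simp add: count_ge_move_le)
      ultimately show ?thesis using occ by simp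
    qed
    then have "sweep_to (Suc m) f X =
        row_op H m ?i ?g X + (\<Sum>a | a \<in> X \<and> a < m. W X a m * ?g (move X a m))"
      using False Suc.IH[of X] Suc.prems i by (simp add: jump_to_def)
    moreover have "row_op H (Suc m) ?i ?g X =
        row_op H m ?i ?g X + (\<Sum>a | a \<in> X \<and> a < m. W X a m * ?g (move X a m))"
    proof -
      let ?J = "\<lambda>m. {J \<in> jumps m X. jump_row H X J = ?i}"
      let ?N = "(\<lambda>a. (a, m)) ` {a. a \<in> X \<and> a < m}"
      \<comment> \<open>Raising the bound by one adds exactly the jumps into the free site
        \<open>m\<close>.\<close>
      have J: "?J (Suc m) = ?J m \<union> ?N"
        using False i by (auto simp: jumps_def jump_row_def less_Suc_eq)
      have "finite (?J m)" by (rule finite_subset[OF _ finite_jumps[of m X]]) auto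
      moreover have "?J m \<inter> ?N = {}" by (auto simp: jumps_def)
      moreover have "finite ?N" by auto
      ultimately have "(\<Sum>(a, b)\<in>?J (Suc m). W X a b * ?g (move X a b)) =
          (\<Sum>(a, b)\<in>?J m. W X a b * ?g (move X a b)) +
          (\<Sum>(a, b)\<in>?N. W X a b * ?g (move X a b))"
        unfolding J by (intro sum.union_disjoint)
      then show ?thesis
        unfolding row_op_def by (simp add: sum.reindex inj_on_def add_ac)
    qed
    ultimately show ?thesis by simp
  qed
qed

text \<open>Both products are sweeps over all \<open>n\<close> sites, starting at row 0 because no
  particle lies at \<open>n\<close> or beyond.\<close>

theorem rows_op_H_eq_T:
  assumes "X \<subseteq> {..<n}" "card X = k"
  shows "rows_op H n k 0 f X = rows_op T n k 0 f X"
proof -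
  have fin: "finite X" using assms finite_subset by blast
  have "{x \<in> X. n \<le> x} = {}" using assms by auto
  then have 0: "count_ge X n = 0" unfolding count_ge_def by (metis card.empty)
  have "rows_op T n k 0 f X = sweep_to n f X"
    using sweep_from_eq_rows_op[OF assms, of n f] 0 by (simp add: sweep_from_eq_sweep_to)
  also have "\<dots> = row_op H n 0 (rows_op H n k (Suc 0) f) X"
    using sweep_to_eq_row_op[OF assms, of n f] 0 by simp
  also have "\<dots> = rows_op H n k 0 f X" using fin assms by (simp add: rows_op_step)
  finally show ?thesis by simp
qed

end


section \<open>Ribbons as particle jumps\<close>

text \<open>Sites start at 0, so the index \<open>c\<close> of the diagonal term is
  \<open>Suc\<close> of the site.\<close>

definition site :: "nat \<Rightarrow> (nat \<Rightarrow> nat) \<Rightarrow> nat \<Rightarrow> nat" where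
  "site k \<nu> i = \<nu> i + k - i"

definition sites :: "nat \<Rightarrow> (nat \<Rightarrow> nat) \<Rightarrow> nat set" where
  "sites k \<nu> = site k \<nu> ` {1..k}"

lemma parts_antimono:
  assumes "\<nu> \<in> parts n k" "1 \<le> i" "i \<le> j"
  shows "\<nu> j \<le> \<nu> i"
  using assms(3)
proof (induction rule: dec_induct)
  case base
  then show ?case by simp
next
  case (step r)
  have "\<nu> (Suc r) \<le> \<nu> r"
  proof (cases "r < k")
    case True
    then show ?thesis using assms step by (auto simp: parts_def)
  next
    case False
    then have "\<nu> (Suc r) = 0" using assms(1) by (auto simp: parts_def)
    then show ?thesis by simp
  qed
  with step show ?case by simp
qed

lemma site_less:
  assumes "\<nu> \<in> parts n k" "1 \<le> i" "i < j" "j \<le> k"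
  shows "site k \<nu> j < site k \<nu> i"
  using parts_antimono[of \<nu> n k i j] assms by (simp add: site_def)

lemma site_less_iff:
  assumes "\<nu> \<in> parts n k" "i \<in> {1..k}" "j \<in> {1..k}"
  shows "site k \<nu> j < site k \<nu> i \<longleftrightarrow> i < j"
  using site_less[OF assms(1), of i j] site_less[OF assms(1), of j i] assms
  by (cases i j rule: linorder_cases) auto

lemma inj_on_site: "\<nu> \<in> parts n k \<Longrightarrow> inj_on (site k \<nu>) {1..k}"
  by (rule inj_onI) (metis linorder_neqE_nat less_irrefl site_less_iff)

lemma finite_sites [simp]: "finite (sites k \<nu>)"
  by (simp add: sites_def)

lemma card_sites: "\<nu> \<in> parts n k \<Longrightarrow> card (sites k \<nu>) = k"
  unfolding sites_def using card_image[OF inj_on_site] by simp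

lemma sites_subset:
  assumes "\<nu> \<in> parts n k" "k \<le> n"
  shows "sites k \<nu> \<subseteq> {..<n}"
proof
  fix x assume "x \<in> sites k \<nu>"
  then obtain i where i: "x = \<nu> i + k - i" "1 \<le> i" "i \<le> k" by (auto simp: sites_def site_def)
  then have "\<nu> i \<le> n - k" using assms by (auto simp: parts_def)
  with i assms show "x \<in> {..<n}" by auto
qed

lemma count_ge_sites:
  assumes "\<nu> \<in> parts n k" "i \<le> Suc k" "\<And>r. 1 \<le> r \<Longrightarrow> r \<le> k \<Longrightarrow> b \<le> site k \<nu> r \<longleftrightarrow> r < i"
  shows "count_ge (sites k \<nu>) b = i - 1"
proof -
  have "{x \<in> sites k \<nu>. b \<le> x} = site k \<nu> ` {1..<i}"
    using assms by (fastforce simp: sites_def)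
  moreover have "inj_on (site k \<nu>) {1..<i}"
    by (rule inj_on_subset[OF inj_on_site[OF assms(1)]]) (use assms in auto)
  ultimately show ?thesis by (simp add: count_ge_def card_image)
qed

lemma count_ge_Suc_site:
  assumes "\<nu> \<in> parts n k" "i \<in> {1..k}"
  shows "count_ge (sites k \<nu>) (Suc (site k \<nu> i)) = i - 1"
  using assms by (intro count_ge_sites[OF assms(1)]) (auto simp: Suc_le_eq site_less_iff)

text \<open>Counting the particles beyond a site recovers its row, and row and site together give
  the part.\<close>

lemma inj_on_sites: "inj_on (sites k) (parts n k)"
proof (rule inj_onI)
  fix \<mu> \<nu> assume *: "\<mu> \<in> parts n k" "\<nu> \<in> parts n k" "sites k \<mu> = sites k \<nu>"
  show "\<mu> = \<nu>"
  proof
    fix i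
    show "\<mu> i = \<nu> i"
    proof (cases "i \<in> {1..k}")
      case False
      then have "i = 0 \<or> k < i" by auto
      with * show ?thesis unfolding parts_def by (metis (mono_tags, lifting) mem_Collect_eq)
    next
      case True
      then have "site k \<mu> i \<in> sites k \<nu>" using * by (auto simp: sites_def)
      then obtain j where j: "j \<in> {1..k}" "site k \<mu> i = site k \<nu> j" by (auto simp: sites_def)
      have "i - 1 = j - 1"
        using count_ge_Suc_site[OF *(1) True] count_ge_Suc_site[OF *(2) j(1)] *(3) j by simp
      then have "i = j" using True j by auto
      with j True show ?thesis by (auto simp: site_def)
    qed
  qed
qed

section \<open>Ribbons described row by row\<close>

text \<open>The last condition says that adjacent rows overlap in exactly one column. In terms of
  sites it says that row \<open>Suc r\<close> of \<open>\<mu>\<close> has the site of row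
  \<open>r\<close> of \<open>\<nu>\<close>.\<close>

definition ribbon_rows :: "nat \<Rightarrow> (nat \<Rightarrow> nat) \<Rightarrow> (nat \<Rightarrow> nat) \<Rightarrow> nat \<Rightarrow> nat \<Rightarrow> bool" where
  "ribbon_rows k \<mu> \<nu> i j \<longleftrightarrow> 1 \<le> i \<and> i \<le> j \<and> j \<le> k \<and> \<nu> i < \<mu> i \<and>
     (\<forall>r. r < i \<or> j < r \<longrightarrow> \<mu> r = \<nu> r) \<and> (\<forall>r. i \<le> r \<and> r < j \<longrightarrow> \<mu> (Suc r) = Suc (\<nu> r))"

lemma ribbon_rows_less:
  assumes "ribbon_rows k \<mu> \<nu> i j" "\<nu> \<in> parts n k" "i \<le> r" "r \<le> j"
  shows "\<nu> r < \<mu> r"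
proof (cases "r = i")
  case False
  then obtain s where s: "r = Suc s" "i \<le> s" using assms by (cases r) auto
  then have "\<mu> r = Suc (\<nu> s)" "\<nu> r \<le> \<nu> s"
    using assms parts_antimono[of \<nu> n k s r] by (auto simp: ribbon_rows_def)
  then show ?thesis by simp
qed (use assms in \<open>auto simp: ribbon_rows_def\<close>)

lemma skew_row_iff:
  assumes "ribbon_rows k \<mu> \<nu> i j" "\<nu> \<in> parts n k"
  shows "(r, c) \<in> skew k \<mu> \<nu> \<longleftrightarrow> i \<le> r \<and> r \<le> j \<and> \<nu> r < c \<and> c \<le> \<mu> r"
proof -
  have "\<mu> r = \<nu> r" if "r < i \<or> j < r" using that assms by (auto simp: ribbon_rows_def)
  then show ?thesis using assms by (force simp: skew_def ribbon_rows_def)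
qed

lemma rows_skew:
  assumes "ribbon_rows k \<mu> \<nu> i j" "\<nu> \<in> parts n k"
  shows "fst ` skew k \<mu> \<nu> = {i..j}"
proof (rule set_eqI)
  fix r
  have "r \<in> fst ` skew k \<mu> \<nu> \<longleftrightarrow> (\<exists>c. (r, c) \<in> skew k \<mu> \<nu>)" by force
  also have "\<dots> \<longleftrightarrow> r \<in> {i..j}"
    using ribbon_rows_less[OF assms, of r] by (auto simp: skew_row_iff[OF assms])
  finally show "r \<in> fst ` skew k \<mu> \<nu> \<longleftrightarrow> r \<in> {i..j}" .
qed

lemma columns_skew:
  assumes "ribbon_rows k \<mu> \<nu> i j" "\<nu> \<in> parts n k" "\<mu> \<in> parts n k"
  shows "snd ` skew k \<mu> \<nu> = {\<nu> j<..\<mu> i}"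
proof
  have "\<nu> j \<le> \<nu> r \<and> \<mu> r \<le> \<mu> i" if "i \<le> r" "r \<le> j" for r
    using that assms parts_antimono[of \<nu> n k r j] parts_antimono[of \<mu> n k i r]
    by (auto simp: ribbon_rows_def)
  then show "snd ` skew k \<mu> \<nu> \<subseteq> {\<nu> j<..\<mu> i}"
    using skew_row_iff[OF assms(1,2)] by fastforce
next
  have "{\<nu> r<..\<mu> i} \<subseteq> snd ` skew k \<mu> \<nu>" if "i \<le> r" "r \<le> j" for r
    using that
  proof (induction rule: dec_induct)
    case base
    have "(i, c) \<in> skew k \<mu> \<nu>" if "\<nu> i < c" "c \<le> \<mu> i" for c
      using that base skew_row_iff[OF assms(1,2)] by simp
    then show ?case by force
  next
    case (step r)
    have "(Suc r, c) \<in> skew k \<mu> \<nu>" if "\<nu> (Suc r) < c" "c \<le> \<nu> r" for c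
      using that step skew_row_iff[OF assms(1,2), of "Suc r" c] assms(1)
      by (simp add: ribbon_rows_def)
    then have "{\<nu> (Suc r)<..\<nu> r} \<subseteq> snd ` skew k \<mu> \<nu>" by force
    moreover have "{\<nu> r<..\<mu> i} \<subseteq> snd ` skew k \<mu> \<nu>" using step by simp
    moreover have "{\<nu> (Suc r)<..\<mu> i} \<subseteq> {\<nu> (Suc r)<..\<nu> r} \<union> {\<nu> r<..\<mu> i}" by auto
    ultimately show ?case by blast
  qed
  then show "{\<nu> j<..\<mu> i} \<subseteq> snd ` skew k \<mu> \<nu>" using assms(1) by (auto simp: ribbon_rows_def)
qed

text \<open>A path from a row up to \<open>r\<close> to a row beyond \<open>r\<close> must step from
  row \<open>r\<close> to row \<open>Suc r\<close> somewhere, and such a step stays in its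
  column.\<close>

lemma box_connected_crossing:
  assumes "box_connected S" "(r1, c1) \<in> S" "(r2, c2) \<in> S" "r1 \<le> r" "r < r2"
  shows "\<exists>c. (r, c) \<in> S \<and> (Suc r, c) \<in> S"
proof (rule ccontr)
  assume no: "\<not> ?thesis"
  let ?R = "{(x, y). x \<in> S \<and> y \<in> S \<and> box_adj x y}"
  have "((r1, c1), (r2, c2)) \<in> ?R\<^sup>*" using assms by (auto simp: box_connected_def)
  then have "fst (r2, c2) \<le> r"
  proof (induction rule: rtrancl_induct)
    case base
    then show ?case using assms by simp
  next
    case (step x y)
    show ?case
    proof (rule ccontr)
      assume "\<not> fst y \<le> r"
      with step have "snd x = snd y" "fst x = r" "fst y = Suc r" by (auto simp: box_adj_def)
      with step no show False by (metis (no_types, lifting) case_prodD mem_Collect_eq prod.collapse)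
    qed
  qed
  then show False using assms by simp
qed

text \<open>Connectedness makes adjacent rows share a column, and a second shared column would
  create a square.\<close>

lemma ribbon_rowsI:
  assumes "is_ribbon k \<mu> \<nu>" "\<mu> \<in> parts n k" "\<nu> \<in> parts n k"
  obtains i j where "ribbon_rows k \<mu> \<nu> i j"
proof -
  let ?S = "skew k \<mu> \<nu>"
  have "?S \<subseteq> {1..k} \<times> {..\<mu> 1}"
    using parts_antimono[OF assms(2), of 1] by (force simp: skew_def)
  then have fin: "finite (fst ` ?S)" by (meson finite_SigmaI finite_atLeastAtMost finite_atMost
      finite_imageI finite_subset)
  have ne: "fst ` ?S \<noteq> {}" using assms(1) by (auto simp: is_ribbon_def)
  define i j where "i = Min (fst ` ?S)" and "j = Max (fst ` ?S)"
  obtain ci cj where ends: "(i, ci) \<in> ?S" "(j, cj) \<in> ?S"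
    using Min_in[OF fin ne] Max_in[OF fin ne] by (force simp: i_def j_def)
  have range: "i \<le> r \<and> r \<le> j" if "(r, c) \<in> ?S" for r c
    using Min_le[OF fin, of r] Max_ge[OF fin, of r] that by (force simp: i_def j_def)
  have "\<mu> r = \<nu> r" if "r < i \<or> j < r" for r
  proof (cases "r \<in> {1..k}")
    case True
    then have "(r, \<mu> r) \<notin> ?S" using range that by fastforce
    then have "\<mu> r \<le> \<nu> r" using True by (auto simp: skew_def)
    moreover have "\<nu> r \<le> \<mu> r" using assms(1) True by (auto simp: is_ribbon_def)
    ultimately show ?thesis by simp
  next
    case False
    then have "r = 0 \<or> k < r" by auto
    then show ?thesis using assms by (auto simp: parts_def)
  qed
  moreover have "\<mu> (Suc r) = Suc (\<nu> r)" if r: "i \<le> r" "r < j" for r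
  proof -
    obtain c where c: "(r, c) \<in> ?S" "(Suc r, c) \<in> ?S"
      using box_connected_crossing[OF _ ends r] assms(1) by (auto simp: is_ribbon_def)
    have rk: "1 \<le> r" "Suc r \<le> k" "\<nu> r < \<mu> (Suc r)" using c by (auto simp: skew_def)
    have le: "\<nu> (Suc r) \<le> \<nu> r" "\<mu> (Suc r) \<le> \<mu> r"
      using assms rk parts_antimono[of _ n k r "Suc r"] by auto
    have "\<not> Suc (\<nu> r) < \<mu> (Suc r)"
    proof
      assume "Suc (\<nu> r) < \<mu> (Suc r)"
      then have "(r, Suc (\<nu> r)) \<in> ?S" "(Suc r, Suc (\<nu> r)) \<in> ?S"
          "(r, Suc (Suc (\<nu> r))) \<in> ?S" "(Suc r, Suc (Suc (\<nu> r))) \<in> ?S"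
        using rk le by (auto simp: skew_def)
      then show False using assms(1) by (auto simp: is_ribbon_def no_square_def)
    qed
    with rk show ?thesis by simp
  qed
  ultimately have "ribbon_rows k \<mu> \<nu> i j"
    using ends range by (auto simp: ribbon_rows_def skew_def)
  then show ?thesis by (rule that)
qed

text \<open>Every box is joined to the head: go right to the end of the row, up through the column
  shared with the row above, and repeat. Symmetry of adjacency then joins any two boxes.\<close>

lemma is_ribbonI:
  assumes "ribbon_rows k \<mu> \<nu> i j" "\<mu> \<in> parts n k" "\<nu> \<in> parts n k"
  shows "is_ribbon k \<mu> \<nu>"
  unfolding is_ribbon_def
proof (intro conjI allI impI)
  let ?S = "skew k \<mu> \<nu>"
  let ?R = "{(x, y). x \<in> ?S \<and> y \<in> ?S \<and> box_adj x y}"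
  note S = skew_row_iff[OF assms(1,3)]
  have ij: "i \<le> j" using assms by (simp add: ribbon_rows_def)
  show "\<nu> r \<le> \<mu> r" for r
    using ribbon_rows_less[OF assms(1,3), of r] assms(1)
    by (cases "i \<le> r \<and> r \<le> j") (auto simp: ribbon_rows_def)
  show "?S \<noteq> {}" using rows_skew[OF assms(1,3)] ij by auto
  show "no_square ?S"
    unfolding no_square_def
  proof clarify
    fix r c
    assume "(r, c) \<in> ?S" "(Suc r, Suc c) \<in> ?S"
    then show False using assms(1) by (auto simp: S ribbon_rows_def)
  qed
  have sym: "sym (?R\<^sup>*)" by (rule sym_rtrancl) (auto simp: sym_def box_adj_def)
  have row: "((r, c), (r, \<mu> r)) \<in> ?R\<^sup>*" if c: "(r, c) \<in> ?S" for r c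
  proof -
    have "c \<le> \<mu> r" using c by (simp add: S)
    then show ?thesis
    proof (induction rule: inc_induct)
      case base
      then show ?case by simp
    next
      case (step e)
      then have "((r, e), (r, Suc e)) \<in> ?R" using c by (auto simp: S box_adj_def)
      then show ?case using step.IH by (rule converse_rtrancl_into_rtrancl)
    qed
  qed
  have head: "((r, \<mu> r), (i, \<mu> i)) \<in> ?R\<^sup>*" if "i \<le> r" "r \<le> j" for r
    using that
  proof (induction rule: dec_induct)
    case base
    then show ?case by simp
  next
    case (step r)
    have up: "(Suc r, \<mu> (Suc r)) \<in> ?S" "(r, \<mu> (Suc r)) \<in> ?S"
      using step ribbon_rows_less[OF assms(1,3), of r] ribbon_rows_less[OF assms(1,3), of "Suc r"]
        assms(1) by (auto simp: S ribbon_rows_def)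
    then have "((Suc r, \<mu> (Suc r)), (r, \<mu> (Suc r))) \<in> ?R" by (simp add: box_adj_def)
    also have "((r, \<mu> (Suc r)), (r, \<mu> r)) \<in> ?R\<^sup>*" using up by (intro row)
    also have "((r, \<mu> r), (i, \<mu> i)) \<in> ?R\<^sup>*" using step by simp
    finally show ?case .
  qed
  have to_head: "(x, (i, \<mu> i)) \<in> ?R\<^sup>*" if "x \<in> ?S" for x
  proof -
    obtain r c where x: "x = (r, c)" by (cases x)
    show ?thesis using row[of r c] head[of r] that by (auto simp: x S intro: rtrancl_trans)
  qed
  show "box_connected ?S"
    unfolding box_connected_def using to_head symD[OF sym] by (meson rtrancl_trans)
qed

section \<open>Correspondence between ribbons and jumps\<close>

lemma ribbon_statistics:
  assumes "ribbon_rows k \<mu> \<nu> i j" "\<mu> \<in> parts n k" "\<nu> \<in> parts n k"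
  shows "head_row k \<mu> \<nu> = i" "tail_row k \<mu> \<nu> = j"
    "hval k \<mu> \<nu> = Suc (site k \<mu> i)" "tval k \<mu> \<nu> = Suc (site k \<nu> j)"
    "ribbon_ht k \<mu> \<nu> - 1 = j - i" "ribbon_wd k \<mu> \<nu> - 1 = \<mu> i - \<nu> j - 1"
proof -
  have ij: "1 \<le> i" "i \<le> j" "j \<le> k" using assms by (auto simp: ribbon_rows_def)
  note rows = rows_skew[OF assms(1,3)]
  show ends: "head_row k \<mu> \<nu> = i" "tail_row k \<mu> \<nu> = j"
    unfolding head_row_def tail_row_def rows using ij by (auto intro: Min_eqI Max_eqI)
  show "hval k \<mu> \<nu> = Suc (site k \<mu> i)" "tval k \<mu> \<nu> = Suc (site k \<nu> j)"
    using ij by (auto simp: hval_def tval_def ends site_def)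
  show "ribbon_ht k \<mu> \<nu> - 1 = j - i" using ij by (simp add: ribbon_ht_def rows)
  show "ribbon_wd k \<mu> \<nu> - 1 = \<mu> i - \<nu> j - 1"
    by (simp add: ribbon_wd_def columns_skew[OF assms(1,3,2)])
qed

text \<open>The particles of rows \<open>i\<close> to \<open>j - 1\<close> keep their sites and drop
  by one row. The third claim ranks the new site among the old ones.\<close>

lemma site_ribbon:
  assumes "ribbon_rows k \<mu> \<nu> i j" "\<mu> \<in> parts n k" "\<nu> \<in> parts n k" "r \<in> {1..k}"
  shows "r < i \<or> j < r \<Longrightarrow> site k \<mu> r = site k \<nu> r"
    and "i < r \<Longrightarrow> r \<le> j \<Longrightarrow> site k \<mu> r = site k \<nu> (r - 1)"
    and "site k \<mu> i \<le> site k \<nu> r \<longleftrightarrow> r < i"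
proof -
  have ij: "1 \<le> i" "i \<le> j" "j \<le> k" "\<nu> i < \<mu> i" using assms by (auto simp: ribbon_rows_def)
  show out: "site k \<mu> r = site k \<nu> r" if "r < i \<or> j < r"
    using that assms by (auto simp: ribbon_rows_def site_def)
  show "site k \<mu> r = site k \<nu> (r - 1)" if "i < r" "r \<le> j"
    using that assms ij by (cases r) (auto simp: ribbon_rows_def site_def)
  have "site k \<nu> i < site k \<mu> i" using ij by (simp add: site_def)
  then show "site k \<mu> i \<le> site k \<nu> r \<longleftrightarrow> r < i"
    using out site_less_iff[OF assms(2), of r i] site_less_iff[OF assms(3), of i r] assms(4) ij
    by (cases r i rule: linorder_cases) auto
qed

lemma ribbon_move:
  assumes "ribbon_rows k \<mu> \<nu> i j" "\<mu> \<in> parts n k" "\<nu> \<in> parts n k"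
  defines "a \<equiv> site k \<nu> j" and "b \<equiv> site k \<mu> i"
  shows "sites k \<mu> = move (sites k \<nu>) a b" "a \<in> sites k \<nu>" "b \<notin> sites k \<nu>" "a < b"
    "count_ge (sites k \<nu>) b = i - 1" "count_ge (sites k \<nu>) (Suc a) = j - 1"
    "card (sites k \<nu> \<inter> {a<..<b}) = j - i" "card ({a<..<b} - sites k \<nu>) = \<mu> i - \<nu> j - 1"
proof -
  have ij: "1 \<le> i" "i \<le> j" "j \<le> k" using assms by (auto simp: ribbon_rows_def)
  note sr = site_ribbon[OF assms(1-3)]
  show a: "a \<in> sites k \<nu>" using ij by (simp add: a_def sites_def)
  show b: "b \<notin> sites k \<nu>"
  proof
    assume "b \<in> sites k \<nu>"
    then obtain r where r: "r \<in> {1..k}" "b = site k \<nu> r" by (auto simp: sites_def)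
    then have "r < i" using sr(3)[of r] by (simp add: b_def)
    then have "site k \<mu> r = site k \<mu> i" using sr(1)[of r] r by (simp add: b_def)
    then show False using \<open>r < i\<close> site_less_iff[OF assms(2), of r i] r ij by simp
  qed
  show ab: "a < b" using sr(3)[of j] ij by (auto simp: a_def b_def)
  show "count_ge (sites k \<nu>) b = i - 1"
    using ij sr(3) by (intro count_ge_sites[OF assms(3)]) (auto simp: b_def)
  show "count_ge (sites k \<nu>) (Suc a) = j - 1"
    using ij count_ge_Suc_site[OF assms(3), of j] by (simp add: a_def)
  \<comment> \<open>One inclusion suffices, since both sets have \<open>k\<close> elements.\<close>
  have "sites k \<mu> \<subseteq> move (sites k \<nu>) a b"
  proof
    fix x assume "x \<in> sites k \<mu>"
    then obtain r where r: "r \<in> {1..k}" "x = site k \<mu> r" by (auto simp: sites_def)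
    consider "r < i \<or> j < r" | "r = i" | "i < r" "r \<le> j" by linarith
    then obtain s where "x = b \<or> (s \<in> {1..k} \<and> s \<noteq> j \<and> x = site k \<nu> s)"
    proof cases
      case 1
      then show ?thesis using that[of r] sr(1)[of r] r ij by auto
    next
      case 2
      then show ?thesis using that r by (auto simp: b_def)
    next
      case 3
      then have "r - 1 \<in> {1..k}" "r - 1 \<noteq> j" using r ij by auto
      then show ?thesis using that[of "r - 1"] sr(2)[of r] r 3 by auto
    qed
    then show "x \<in> move (sites k \<nu>) a b"
      using inj_onD[OF inj_on_site[OF assms(3)], of s j] ij by (auto simp: move_def a_def sites_def)
  qed
  moreover have "card (move (sites k \<nu>) a b) = card (sites k \<mu>)"
    using card_move[OF _ a b card_sites[OF assms(3)]] card_sites[OF assms(2)] by simp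
  ultimately show "sites k \<mu> = move (sites k \<nu>) a b"
    by (intro card_subset_eq) (auto simp: move_def)
  have between: "r \<in> {i..<j} \<longleftrightarrow> site k \<nu> r \<in> {a<..<b}" if "r \<in> {1..k}" for r
    using that sr(3)[of r] site_less_iff[OF assms(3), of r j] ij by (auto simp: a_def b_def)
  have "sites k \<nu> \<inter> {a<..<b} = site k \<nu> ` {r \<in> {1..k}. site k \<nu> r \<in> {a<..<b}}"
    by (auto simp: sites_def)
  also have "{r \<in> {1..k}. site k \<nu> r \<in> {a<..<b}} = {i..<j}"
  proof (rule set_eqI)
    show "r \<in> {r \<in> {1..k}. site k \<nu> r \<in> {a<..<b}} \<longleftrightarrow> r \<in> {i..<j}" for r
      using between[of r] ij by (cases "r \<in> {1..k}") auto
  qed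
  finally have "sites k \<nu> \<inter> {a<..<b} = site k \<nu> ` {i..<j}" .
  moreover have "inj_on (site k \<nu>) {i..<j}"
    by (rule inj_on_subset[OF inj_on_site[OF assms(3)]]) (use ij in auto)
  ultimately show occ: "card (sites k \<nu> \<inter> {a<..<b}) = j - i" by (simp add: card_image)
  \<comment> \<open>There are \<open>b - a - 1\<close> sites in between, where \<open>b - a\<close>
    is \<open>\<mu> i - \<nu> j\<close> plus \<open>j - i\<close>.\<close>
  have "card ({a<..<b} - sites k \<nu>) = card {a<..<b} - card (sites k \<nu> \<inter> {a<..<b})"
    by (metis Int_commute card_Diff_subset_Int finite_greaterThanLessThan finite_Int)
  also have "\<dots> = \<mu> i - \<nu> j - 1"
    using occ ab ij by (simp add: a_def b_def site_def)
  finally show "card ({a<..<b} - sites k \<nu>) = \<mu> i - \<nu> j - 1" .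
qed

lemma move_ribbon:
  assumes "\<nu> \<in> parts n k" "k \<le> n" "a \<in> sites k \<nu>" "b \<notin> sites k \<nu>" "a < b" "b < n"
  obtains \<mu> i j where "\<mu> \<in> parts n k" "ribbon_rows k \<mu> \<nu> i j" "a = site k \<nu> j" "b = site k \<mu> i"
proof -
  obtain j where j: "j \<in> {1..k}" "a = site k \<nu> j" using assms by (auto simp: sites_def)
  \<comment> \<open>The first row whose particle lies left of \<open>b\<close> is the row of the
    particle placed at \<open>b\<close>.\<close>
  define i where "i = (LEAST r. 1 \<le> r \<and> site k \<nu> r < b)"
  have i: "1 \<le> i" "site k \<nu> i < b" "i \<le> j"
    using LeastI[of "\<lambda>r. 1 \<le> r \<and> site k \<nu> r < b" j]
      Least_le[of "\<lambda>r. 1 \<le> r \<and> site k \<nu> r < b" j] j assms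
    by (auto simp: i_def)
  have gt: "b < site k \<nu> r" if "1 \<le> r" "r < i" for r
  proof -
    have "\<not> site k \<nu> r < b" using that not_less_Least[of r] by (auto simp: i_def)
    moreover have "site k \<nu> r \<in> sites k \<nu>" using that i j by (auto simp: sites_def)
    ultimately show ?thesis using assms by (metis linorder_neqE_nat)
  qed
  \<comment> \<open>A particle that keeps its site but drops by one row gets a part larger by one,
    hence \<open>Suc (\<nu> (r - 1))\<close>.\<close>
  define \<mu> where
    "\<mu> = (\<lambda>r. if r = i then b - (k - i) else if i < r \<and> r \<le> j then Suc (\<nu> (r - 1)) else \<nu> r)"
  have ik: "i \<le> k" using i j by simp
  have \<mu>i: "\<mu> i + (k - i) = b" using i ik by (simp add: \<mu>_def site_def)
  have rib: "ribbon_rows k \<mu> \<nu> i j"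
    unfolding ribbon_rows_def
  proof (intro conjI allI impI)
    show "\<nu> i < \<mu> i" using i(2) \<mu>i ik by (simp add: site_def)
  qed (use i j in \<open>auto simp: \<mu>_def\<close>)
  have "\<mu> \<in> parts n k"
    unfolding parts_def
  proof (intro CollectI conjI allI impI)
    fix r assume "r = 0 \<or> k < r"
    then show "\<mu> r = 0" using i j assms(1) by (auto simp: \<mu>_def parts_def)
  next
    fix r assume r: "1 \<le> r" "r < k"
    have dec: "\<nu> (Suc s) \<le> \<nu> s" if "1 \<le> s" for s using parts_antimono[OF assms(1) that] by simp
    consider "Suc r < i" | "Suc r = i" | "r = i" | "i < r" "r \<le> j" | "j < r" by linarith
    then show "\<mu> (Suc r) \<le> \<mu> r"
    proof cases
      case 2
      then have "b < site k \<nu> r" using gt r by simp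
      then show ?thesis using 2 \<mu>i r ik by (auto simp: \<mu>_def site_def)
    next
      case 3
      have "\<mu> (Suc r) \<le> Suc (\<nu> r)" using dec[of r] r 3 by (auto simp: \<mu>_def)
      also have "\<dots> \<le> \<mu> r" using rib 3 by (simp add: ribbon_rows_def)
      finally show ?thesis .
    next
      case 4
      then have "\<nu> r \<le> \<nu> (r - 1)" using dec[of "r - 1"] i by simp
      then show ?thesis using dec[of r] r 4 by (auto simp: \<mu>_def)
    qed (use dec[of r] r i in \<open>auto simp: \<mu>_def\<close>)
  next
    fix r assume r: "1 \<le> r" "r \<le> k"
    have le: "\<nu> s \<le> n - k" if "1 \<le> s" for s
      using that assms(1) by (cases "s \<le> k") (auto simp: parts_def)
    \<comment> \<open>In the first row the bound comes from \<open>b < n\<close>, in any other row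
      from the old part above it.\<close>
    have bi: "\<mu> i \<le> n - k"
    proof (cases "i = 1")
      case True
      then show ?thesis using \<mu>i assms ik by simp
    next
      case False
      then have "b < site k \<nu> (i - 1)" using gt[of "i - 1"] i by simp
      then have "\<mu> i \<le> \<nu> (i - 1)" using \<mu>i False i ik by (simp add: site_def)
      also have "\<dots> \<le> n - k" using le False i by simp
      finally show ?thesis .
    qed
    have "\<nu> (r - 1) < \<mu> i" if "i < r"
    proof -
      have "\<nu> (r - 1) \<le> \<nu> i" using that i by (intro parts_antimono[OF assms(1)]) auto
      also have "\<dots> < \<mu> i" using rib by (simp add: ribbon_rows_def)
      finally show ?thesis .
    qed
    then show "\<mu> r \<le> n - k"
      using bi le[of r] r by (cases "r = i") (auto simp: \<mu>_def[THEN fun_cong, of r])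
  qed
  moreover have "b = site k \<mu> i" using \<mu>i ik by (simp add: site_def)
  ultimately show ?thesis using that rib j by blast
qed


section \<open>Row sums\<close>

definition jump_weight :: "rend \<Rightarrow> 'a::comm_ring_1 \<Rightarrow> 'a \<Rightarrow> 'a \<Rightarrow> (nat \<Rightarrow> 'a) \<Rightarrow>
    nat set \<Rightarrow> nat \<Rightarrow> nat \<Rightarrow> 'a" where
  "jump_weight y p q hb t X a b = (hb - (p - q) * t (Suc (case y of H \<Rightarrow> b | T \<Rightarrow> a))) *
     p ^ card (X \<inter> {a<..<b}) * q ^ card ({a<..<b} - X)"

text \<open>Inside the interval a particle and a hole exchange places, which preserves both
  counts.\<close>

lemma jump_weight_move_between:
  assumes "a < m" "m < b" "b < c" "m \<in> X" "b \<notin> X"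
  shows "jump_weight y p q hb t (move X m b) a c = jump_weight y p q hb t X a c"
proof -
  have "move X m b \<inter> {a<..<c} = move (X \<inter> {a<..<c}) m b"
    "{a<..<c} - move X m b = move ({a<..<c} - X) b m"
    using assms by (auto simp: move_def)
  moreover have "card (move (X \<inter> {a<..<c}) m b) = card (X \<inter> {a<..<c})"
    "card (move ({a<..<c} - X) b m) = card ({a<..<c} - X)"
    using assms by (auto intro!: card_move)
  ultimately show ?thesis by (simp add: jump_weight_def)
qed

lemma jump_weight_move_around:
  assumes "a < m" "m < b" "b < c"
  shows "jump_weight y p q hb t (move X a c) m b = jump_weight y p q hb t X m b"
proof -
  have "move X a c \<inter> {m<..<b} = X \<inter> {m<..<b}" "{m<..<b} - move X a c = {m<..<b} - X"
    using assms by (auto simp: move_def)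
  then show ?thesis by (simp add: jump_weight_def)
qed

text \<open>\<open>[:0, w:]\<close> is \<open>w\<close> times the formal variable that counts the
  factors.\<close>

lemma jump_weights_poly: "jump_weights (\<lambda>X a b. [:0, jump_weight y p q hb t X a b:])"
  by unfold_locales (simp_all add: jump_weight_move_between jump_weight_move_around)

lemma finite_parts: "finite (parts n k)"
proof (rule finite_subset)
  show "parts n k \<subseteq> {\<nu>. \<forall>i. (i \<in> {1..k} \<longrightarrow> \<nu> i \<in> {..n - k}) \<and> (i \<notin> {1..k} \<longrightarrow> \<nu> i = 0)}"
    by (auto simp: parts_def not_le)
qed (intro finite_set_of_finite_funs; simp)

lemma wgt_eq_jump_weight:
  assumes "ribbon_rows k \<mu> \<nu> i j" "\<mu> \<in> parts n k" "\<nu> \<in> parts n k"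
  shows "wgt y p q hb t k \<mu> \<nu> = jump_weight y p q hb t (sites k \<nu>) (site k \<nu> j) (site k \<mu> i)"
  using ribbon_statistics[OF assms] ribbon_move(7,8)[OF assms]
  by (simp add: wgt_def jump_weight_def end_val_def split: rend.splits)

text \<open>The pair consists of tail site and head site, with \<open>- 1\<close> passing from the
  values counted from 1 to sites. The jump determines the new configuration, hence the partition by
  \<open>inj_on_sites\<close>; \<open>move_ribbon\<close> gives surjectivity.\<close>

lemma bij_betw_ribbons_jumps:
  fixes n k i x \<nu>
  assumes "\<nu> \<in> parts n k" "k \<le> n"
  shows "bij_betw (\<lambda>\<mu>. (tval k \<mu> \<nu> - 1, hval k \<mu> \<nu> - 1))
    {\<mu> \<in> parts n k. is_ribbon k \<mu> \<nu> \<and> end_row x k \<mu> \<nu> = Suc i}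
    {J \<in> jumps n (sites k \<nu>). jump_row x (sites k \<nu>) J = i}"
    (is "bij_betw ?\<phi> ?R ?J")
proof -
  have moved: "sites k \<mu> = move (sites k \<nu>) (fst (?\<phi> \<mu>)) (snd (?\<phi> \<mu>))" "?\<phi> \<mu> \<in> ?J"
    if \<mu>: "\<mu> \<in> ?R" for \<mu>
  proof -
    obtain r s where rs: "ribbon_rows k \<mu> \<nu> r s" using \<mu> assms ribbon_rowsI by blast
    have \<mu>p: "\<mu> \<in> parts n k" using \<mu> by simp
    note st = ribbon_statistics[OF rs \<mu>p assms(1)] and mv = ribbon_move[OF rs \<mu>p assms(1)]
    show "sites k \<mu> = move (sites k \<nu>) (fst (?\<phi> \<mu>)) (snd (?\<phi> \<mu>))"
      using mv(1) by (simp add: st)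
    have "site k \<mu> r < n" using sites_subset[OF \<mu>p assms(2)] mv(1) by (auto simp: move_def)
    then show "?\<phi> \<mu> \<in> ?J"
      using \<mu> mv(2-6) by (auto simp: st jumps_def jump_row_def end_row_def split: rend.splits)
  qed
  have "inj_on ?\<phi> ?R"
  proof (rule inj_onI)
    fix \<mu> \<mu>' assume *: "\<mu> \<in> ?R" "\<mu>' \<in> ?R" "?\<phi> \<mu> = ?\<phi> \<mu>'"
    then have "sites k \<mu> = sites k \<mu>'" using moved(1)[of \<mu>] moved(1)[of \<mu>'] by simp
    then show "\<mu> = \<mu>'" using * inj_onD[OF inj_on_sites] by blast
  qed
  moreover have "?J \<subseteq> ?\<phi> ` ?R"
  proof
    fix J assume J: "J \<in> ?J"
    obtain a b where ab: "J = (a, b)" by (cases J)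
    have "a \<in> sites k \<nu>" "b \<notin> sites k \<nu>" "a < b" "b < n" using J ab by (auto simp: jumps_def)
    then obtain \<mu> r s where rs: "\<mu> \<in> parts n k" "ribbon_rows k \<mu> \<nu> r s"
        and ends: "a = site k \<nu> s" "b = site k \<mu> r"
      using move_ribbon[OF assms] by metis
    have "1 \<le> r" "1 \<le> s" using rs by (auto simp: ribbon_rows_def)
    then have "\<mu> \<in> ?R"
      using J rs(1) is_ribbonI[OF rs(2,1) assms(1)] ribbon_move(5,6)[OF rs(2,1) assms(1)]
      by (auto simp: ab ends jump_row_def end_row_def ribbon_statistics[OF rs(2,1) assms(1)]
          split: rend.splits)
    moreover have "J = ?\<phi> \<mu>" by (simp add: ab ends ribbon_statistics[OF rs(2,1) assms(1)])
    ultimately show "J \<in> ?\<phi> ` ?R" by blast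
  qed
  ultimately show ?thesis using moved(2) by (auto simp: bij_betw_def)
qed

text \<open>The coefficient at \<open>\<nu>\<close> collects the \<open>\<mu>\<close> that yield
  \<open>\<nu>\<close> by removal of a ribbon. Acting on coefficient functions, \<open>B_op\<close>
  therefore adds ribbons to the argument, as the particle operators do.\<close>

lemma B_op_eq_jumps:
  fixes t :: "nat \<Rightarrow> 'a::comm_ring_1"
  assumes \<nu>: "\<nu> \<in> parts n k" and "k \<le> n" "i < k"
    and g: "\<And>\<mu>. \<mu> \<in> parts n k \<Longrightarrow> g \<mu> = G (sites k \<mu>)"
  shows "B_op x y n k p q hb t (Suc i) g \<nu> =
    (\<Sum>a | a \<in> sites k \<nu> \<and> count_ge (sites k \<nu>) (Suc a) = i. t (Suc a) * G (sites k \<nu>)) +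
    (\<Sum>(a, b)\<in>{J \<in> jumps n (sites k \<nu>). jump_row x (sites k \<nu>) J = i}.
       jump_weight y p q hb t (sites k \<nu>) a b * G (move (sites k \<nu>) a b))"
proof -
  let ?X = "sites k \<nu>"
  let ?R = "{\<mu> \<in> parts n k. is_ribbon k \<mu> \<nu> \<and> end_row x k \<mu> \<nu> = Suc i}"
  let ?h = "\<lambda>(a, b). jump_weight y p q hb t ?X a b * G (move ?X a b)"
  have si: "site k \<nu> (Suc i) \<in> ?X" "count_ge ?X (Suc (site k \<nu> (Suc i))) = i"
    using count_ge_Suc_site[OF \<nu>, of "Suc i"] assms by (auto simp: sites_def)
  have one: "{a. a \<in> ?X \<and> count_ge ?X (Suc a) = i} = {site k \<nu> (Suc i)}"
  proof (intro equalityI subsetI)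
    fix a assume "a \<in> {a. a \<in> ?X \<and> count_ge ?X (Suc a) = i}"
    then have "a \<in> ?X" "count_ge ?X (Suc a) = count_ge ?X (Suc (site k \<nu> (Suc i)))"
      using si(2) by simp_all
    then show "a \<in> {site k \<nu> (Suc i)}"
      using count_ge_Suc_inj[OF finite_sites _ si(1)] by blast
  qed (use si in blast)
  have "B_op x y n k p q hb t (Suc i) g \<nu> = (\<Sum>\<mu>\<in>parts n k.
      (if \<mu> = \<nu> then g \<nu> * t (\<nu> (Suc i) + k + 1 - Suc i) else 0) +
      (if is_ribbon k \<mu> \<nu> \<and> end_row x k \<mu> \<nu> = Suc i then g \<mu> * wgt y p q hb t k \<mu> \<nu> else 0))"
    unfolding B_op_def lin_ext_def B_basis_def using \<nu>
    by (intro sum.cong) (auto simp: distrib_left)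
  also have "\<dots> = t (Suc (site k \<nu> (Suc i))) * g \<nu> + (\<Sum>\<mu>\<in>?R. g \<mu> * wgt y p q hb t k \<mu> \<nu>)"
    using \<nu> finite_parts[of n k] \<open>i < k\<close>
    by (simp add: sum.distrib sum.inter_filter site_def mult.commute Suc_diff_le[symmetric])
  also have "(\<Sum>\<mu>\<in>?R. g \<mu> * wgt y p q hb t k \<mu> \<nu>) =
      (\<Sum>\<mu>\<in>?R. ?h (tval k \<mu> \<nu> - 1, hval k \<mu> \<nu> - 1))"
  proof (rule sum.cong)
    fix \<mu> assume \<mu>: "\<mu> \<in> ?R"
    then obtain r s where rs: "ribbon_rows k \<mu> \<nu> r s" using \<nu> ribbon_rowsI by blast
    have "\<mu> \<in> parts n k" using \<mu> by simp
    note R = rs this \<nu>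
    show "g \<mu> * wgt y p q hb t k \<mu> \<nu> = ?h (tval k \<mu> \<nu> - 1, hval k \<mu> \<nu> - 1)"
      using R by (simp add: wgt_eq_jump_weight[OF R] ribbon_statistics[OF R] g ribbon_move(1)[OF R])
  qed simp
  also have "\<dots> = (\<Sum>J\<in>{J \<in> jumps n ?X. jump_row x ?X J = i}. ?h J)"
    using bij_betw_ribbons_jumps[OF \<nu> \<open>k \<le> n\<close>] by (rule sum.reindex_bij_betw)
  finally show ?thesis using \<nu> by (simp add: one g)
qed

section \<open>Sums over sets of rows as polynomial coefficients\<close>

lemma B_op_sum:
  "B_op x y n k p q hb t i (\<lambda>\<nu>. \<Sum>s\<in>A. h s \<nu>) \<nu> = (\<Sum>s\<in>A. B_op x y n k p q hb t i (h s) \<nu>)"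
  unfolding B_op_def lin_ext_def by (simp add: sum_distrib_right sum.swap[of _ A])

lemma fold_rev_sorted_insert_min:
  assumes "S \<subseteq> {Suc i..k}"
  shows "fold F (rev (sorted_list_of_set (insert i S))) f =
    F i (fold F (rev (sorted_list_of_set S)) f)"
proof -
  have fin: "finite S" using assms finite_subset by blast
  moreover have "i \<notin> S" "\<forall>x\<in>S. i \<le> x" using assms by auto
  ultimately have "sorted_list_of_set (insert i S) = i # sorted_list_of_set S"
    by (simp add: insort_is_Cons)
  then show ?thesis by simp
qed

text \<open>Pascal's rule: split by whether \<open>i\<close> belongs to \<open>S\<close>.\<close>

lemma sum_subsets_card_Suc:
  fixes h :: "nat set \<Rightarrow> 'a::comm_monoid_add"
  assumes "i \<le> k"
  shows "(\<Sum>S | S \<subseteq> {i..k} \<and> card S = Suc s. h S) =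
    (\<Sum>S | S \<subseteq> {Suc i..k} \<and> card S = Suc s. h S) +
    (\<Sum>S | S \<subseteq> {Suc i..k} \<and> card S = s. h (insert i S))"
proof -
  let ?P = "\<lambda>i s. {S. S \<subseteq> {i..k} \<and> card S = s}"
  have fin: "finite (?P i s)" for i s
    by (rule finite_subset[of _ "Pow {i..k}"]) auto
  have Icc: "{i..k} = insert i {Suc i..k}" using assms by auto
  have card_ins: "card (insert i S) = Suc (card S)" if "S \<subseteq> {Suc i..k}" for S
    using that finite_subset[OF that] by (subst card_insert_disjoint) auto
  have "?P i (Suc s) = ?P (Suc i) (Suc s) \<union> insert i ` ?P (Suc i) s"
  proof (intro equalityI subsetI)
    fix S assume S: "S \<in> ?P i (Suc s)"
    show "S \<in> ?P (Suc i) (Suc s) \<union> insert i ` ?P (Suc i) s"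
    proof (cases "i \<in> S")
      case True
      then have "S = insert i (S - {i})" "S - {i} \<subseteq> {Suc i..k}" using S Icc by auto
      moreover from this have "card (S - {i}) = s" using S card_ins[of "S - {i}"] by simp
      ultimately show ?thesis by blast
    next
      case False
      then have "S \<subseteq> {Suc i..k}" using S Icc by auto
      then show ?thesis using S by simp
    qed
  qed (use Icc card_ins in auto)
  moreover have "?P (Suc i) (Suc s) \<inter> insert i ` ?P (Suc i) s = {}" by auto
  moreover have "inj_on (insert i) (?P (Suc i) s)"
  proof (rule inj_onI)
    fix S S' assume "S \<in> ?P (Suc i) s" "S' \<in> ?P (Suc i) s" and eq: "insert i S = insert i S'"
    then have "i \<notin> S" "i \<notin> S'" by auto
    with eq show "S = S'" by (simp add: insert_ident)
  qed
  ultimately show ?thesis using fin by (simp add: sum.union_disjoint sum.reindex)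
qed

text \<open>The row sums of all lengths are the coefficients of one product of row operators over the
  polynomial ring.\<close>

lemma coeff_rows_op:
  fixes t :: "nat \<Rightarrow> 'a::comm_ring_1" and f :: "'a vec"
  assumes "k \<le> n" "i \<le> k" "\<nu> \<in> parts n k"
    and F: "\<And>\<mu>. \<mu> \<in> parts n k \<Longrightarrow> F (sites k \<mu>) = [:f \<mu>:]"
  shows "coeff (jump_weights.rows_op (\<lambda>a. [:1, t (Suc a):])
      (\<lambda>X a b. [:0, jump_weight y p q hb t X a b:]) x n k i F (sites k \<nu>)) r =
    (\<Sum>S | S \<subseteq> {Suc i..k} \<and> card S = r.
      fold (B_op x y n k p q hb t) (rev (sorted_list_of_set S)) f \<nu>)"
  using assms(2,3)
proof (induction i arbitrary: \<nu> r rule: inc_induct)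
  interpret jump_weights "\<lambda>a. [:1, t (Suc a):]" "\<lambda>X a b. [:0, jump_weight y p q hb t X a b:]"
    by (rule jump_weights_poly)
  let ?B = "B_op x y n k p q hb t"
  let ?E = "\<lambda>i r \<nu>. \<Sum>S | S \<subseteq> {Suc i..k} \<and> card S = r. fold ?B (rev (sorted_list_of_set S)) f \<nu>"
  {
    case base
    have none: "{S. S \<subseteq> {Suc k..k} \<and> card S = r} = (if r = 0 then {{}} else {})" by auto
    show ?case unfolding none using F[OF base] by (cases r) (auto simp: rows_op_def)
  next
    case (step i)
    let ?G = "rows_op x n k (Suc i) F"
    have G: "coeff (?G (sites k \<mu>)) s = ?E (Suc i) s \<mu>" if "\<mu> \<in> parts n k" for \<mu> s
      using that by (rule step.IH)
    have "rows_op x n k i F = row_op x n i ?G"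
      using step by (simp add: rows_op_def upt_conv_Cons)
    moreover have "coeff (row_op x n i ?G (sites k \<nu>)) r = ?E i r \<nu>"
    proof (cases r)
      case 0
      have none: "{S. S \<subseteq> {j..k} \<and> card S = 0} = {{}}" for j
        by (auto dest: finite_subset)
      show ?thesis using G[OF step.prems, of 0] unfolding 0
        by (simp add: row_op_def coeff_sum none case_prod_unfold one_pCons)
    next
      case (Suc s)
      \<comment> \<open>Leaving out the row keeps degree \<open>Suc s\<close>; the diagonal term and
        the jumps each carry one factor of the variable and leave degree \<open>s\<close>.\<close>
      have "coeff (row_op x n i ?G (sites k \<nu>)) r = coeff (?G (sites k \<nu>)) (Suc s) +
          ((\<Sum>a | a \<in> sites k \<nu> \<and> count_ge (sites k \<nu>) (Suc a) = i.
              t (Suc a) * coeff (?G (sites k \<nu>)) s) +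
           (\<Sum>(a, b)\<in>{J \<in> jumps n (sites k \<nu>). jump_row x (sites k \<nu>) J = i}.
              jump_weight y p q hb t (sites k \<nu>) a b * coeff (?G (move (sites k \<nu>) a b)) s))"
        unfolding Suc by (simp add: row_op_def coeff_sum case_prod_unfold one_pCons add.assoc)
      also have "\<dots> = ?E (Suc i) (Suc s) \<nu> + ?B (Suc i) (?E (Suc i) s) \<nu>"
        unfolding G[OF step.prems]
        by (subst B_op_eq_jumps[where G = "\<lambda>X. coeff (?G X) s"])
          (use step assms(1) G in auto)
      also have "?B (Suc i) (?E (Suc i) s) \<nu> = (\<Sum>S | S \<subseteq> {Suc (Suc i)..k} \<and> card S = s.
          fold ?B (rev (sorted_list_of_set (insert (Suc i) S))) f \<nu>)"
        by (simp add: B_op_sum fold_rev_sorted_insert_min[where k = k])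
      also have "?E (Suc i) (Suc s) \<nu> + \<dots> = ?E i (Suc s) \<nu>"
        by (rule sum_subsets_card_Suc[symmetric]) (use step in simp)
      finally show ?thesis unfolding Suc .
    qed
    ultimately show ?case by simp
  }
qed

text \<open>Any operator applied last has its values supported in the box; for the empty list the
  result is \<open>f\<close> itself.\<close>

lemma fold_B_op_outside:
  assumes "\<nu> \<notin> parts n k" "f \<nu> = 0"
  shows "fold (B_op x y n k p q hb t) l f \<nu> = 0"
proof (cases l rule: rev_cases)
  case (snoc l' i)
  then show ?thesis using assms(1)
    by (auto simp: B_op_def lin_ext_def B_basis_def intro!: sum.neutral)
qed (use assms in simp)

lemma fold_A_op_outside:
  assumes "\<nu> \<notin> parts n k" "f \<nu> = 0"
  shows "fold (A_op x y n k p q hb t) l f \<nu> = 0"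
proof (cases l rule: rev_cases)
  case (snoc l' i)
  then show ?thesis using assms(1)
    by (auto simp: A_op_def lin_ext_def A_basis_def intro!: sum.neutral)
qed (use assms in simp)

lemma B_sum_H_eq_T:
  assumes "k \<le> n" "\<And>\<nu>. \<nu> \<notin> parts n k \<Longrightarrow> f \<nu> = 0"
  shows "B_sum H y n k p q hb t r f = B_sum T y n k p q hb t r f"
proof
  fix \<nu>
  interpret jump_weights "\<lambda>a. [:1, t (Suc a):]" "\<lambda>X a b. [:0, jump_weight y p q hb t X a b:]"
    by (rule jump_weights_poly)
  \<comment> \<open>The vector \<open>f\<close> is carried over to configurations as constant
    polynomials, so that the degree counts only the chosen rows.\<close>
  define F where "F X = [:f (inv_into (parts n k) (sites k) X):]" for X
  have F: "F (sites k \<mu>) = [:f \<mu>:]" if "\<mu> \<in> parts n k" for \<mu>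
    using that by (simp add: F_def inv_into_f_f[OF inj_on_sites])
  show "B_sum H y n k p q hb t r f \<nu> = B_sum T y n k p q hb t r f \<nu>"
  proof (cases "\<nu> \<in> parts n k")
    case True
    have "B_sum x y n k p q hb t r f \<nu> = coeff (rows_op x n k 0 F (sites k \<nu>)) r" for x
      using coeff_rows_op[where i = 0 and F = F, OF assms(1) _ True F] by (simp add: B_sum_def)
    then show ?thesis
      using rows_op_H_eq_T[OF sites_subset[OF True assms(1)] card_sites[OF True]] by simp
  next
    case False
    then show ?thesis by (simp add: B_sum_def fold_B_op_outside assms)
  qed
qed

section \<open>Transposition, and the identities for \<open>A_sum\<close>\<close>

text \<open>Within the box the two matrices are transposes: both record the same ribbon with the
  same end row and weight, and the diagonals agree.\<close>

lemma A_op_adjoint: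
  "(\<Sum>\<rho>\<in>parts n k. A_op x y n k p q hb t i v \<rho> * f \<rho>) =
   (\<Sum>\<nu>\<in>parts n k. v \<nu> * B_op x y n k p q hb t i f \<nu>)"
proof -
  have "A_basis x y n k p q hb t i \<nu> \<rho> = B_basis x y n k p q hb t i \<rho> \<nu>"
    if "\<nu> \<in> parts n k" "\<rho> \<in> parts n k" for \<nu> \<rho>
    using that by (auto simp: A_basis_def B_basis_def)
  then have "(\<Sum>\<rho>\<in>parts n k. A_op x y n k p q hb t i v \<rho> * f \<rho>) =
      (\<Sum>\<rho>\<in>parts n k. \<Sum>\<nu>\<in>parts n k. v \<nu> * (f \<rho> * B_basis x y n k p q hb t i \<rho> \<nu>))"
    by (simp add: A_op_def lin_ext_def sum_distrib_left sum_distrib_right mult_ac)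
  also have "\<dots> = (\<Sum>\<nu>\<in>parts n k. v \<nu> * B_op x y n k p q hb t i f \<nu>)"
    by (subst sum.swap) (simp add: B_op_def lin_ext_def sum_distrib_left)
  finally show ?thesis .
qed

text \<open>Transposing a product reverses its factors, which turns the increasing order in
  \<open>A_sum\<close> into the decreasing order in \<open>B_sum\<close>.\<close>

lemma fold_A_op_adjoint:
  "(\<Sum>\<rho>\<in>parts n k. fold (A_op x y n k p q hb t) l v \<rho> * f \<rho>) =
   (\<Sum>\<nu>\<in>parts n k. v \<nu> * fold (B_op x y n k p q hb t) (rev l) f \<nu>)"
  by (induction l arbitrary: v) (simp_all add: A_op_adjoint)

lemma A_sum_basis_vec:
  assumes "\<nu> \<in> parts n k" "\<rho> \<in> parts n k"
  shows "A_sum x y n k p q hb t r (basis_vec \<nu>) \<rho> = B_sum x y n k p q hb t r (basis_vec \<rho>) \<nu>"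
proof -
  have "fold (A_op x y n k p q hb t) l (basis_vec \<nu>) \<rho> =
      fold (B_op x y n k p q hb t) (rev l) (basis_vec \<rho>) \<nu>" for l
    using fold_A_op_adjoint[where x = x and y = y and n = n and k = k and p = p and q = q
        and hb = hb and t = t and l = l and v = "basis_vec \<nu>" and f = "basis_vec \<rho>"]
      assms finite_parts[of n k]
    by (simp add: basis_vec_def if_distrib if_distribR cong: if_cong)
  then show ?thesis by (simp add: A_sum_def B_sum_def)
qed

lemma A_sum_H_eq_T:
  fixes t :: "nat \<Rightarrow> 'a::comm_ring_1"
  assumes "k \<le> n" "\<nu> \<in> parts n k"
  shows "A_sum H y n k p q hb t r (basis_vec \<nu>) = A_sum T y n k p q hb t r (basis_vec \<nu>)"
proof
  fix \<rho>
  show "A_sum H y n k p q hb t r (basis_vec \<nu>) \<rho> = A_sum T y n k p q hb t r (basis_vec \<nu>) \<rho>"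
  proof (cases "\<rho> \<in> parts n k")
    case True
    then have "B_sum H y n k p q hb t r (basis_vec \<rho>) = B_sum T y n k p q hb t r (basis_vec \<rho>)"
      using assms by (intro B_sum_H_eq_T) (auto simp: basis_vec_def)
    then show ?thesis using True assms by (simp add: A_sum_basis_vec)
  next
    case False
    then have "basis_vec \<nu> \<rho> = (0 :: 'a)" using assms by (auto simp: basis_vec_def)
    with False show ?thesis by (simp add: A_sum_def fold_A_op_outside)
  qed
qed

theorem theoremA1:
  fixes p q hb :: "'a::comm_ring_1" and t :: "nat \<Rightarrow> 'a" and n k r :: nat
    and la \<mu> :: "nat \<Rightarrow> nat"
  assumes "k \<le> n" and "la \<in> parts n k" and "\<mu> \<in> parts n k" and "r \<le> k"
  shows "A_sum H H n k p q hb t r (basis_vec la) = A_sum T H n k p q hb t r (basis_vec la) \<and>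
         A_sum H T n k p q hb t r (basis_vec la) = A_sum T T n k p q hb t r (basis_vec la) \<and>
         B_sum H H n k p q hb t r (basis_vec \<mu>) = B_sum T H n k p q hb t r (basis_vec \<mu>) \<and>
         B_sum H T n k p q hb t r (basis_vec \<mu>) = B_sum T T n k p q hb t r (basis_vec \<mu>)"
proof -
  have "basis_vec \<mu> \<nu> = (0 :: 'a)" if "\<nu> \<notin> parts n k" for \<nu>
    using that assms by (auto simp: basis_vec_def)
  then show ?thesis using assms by (simp add: A_sum_H_eq_T B_sum_H_eq_T)
qed

end
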